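(* Let $G$ be the complement of a bipartite graph. Then $Tr(G)=D(G)$.
   Context: All graphs are finite and simple. For disjoint vertex sets $A,B$, $A$ dominates $B$ if every vertex of $B$ is adjacent to at least one vertex of $A$. A transitive $k$-partition is a partition of $V(G)$ into $k$ nonempty parts $V_1,\dots,V_k$ with $V_i$ dominating $V_j$ for all $1\le i<j\le k$; $Tr(G)$ is the maximum such $k$. An upper domatic partition of size $k$ is a partition of $V(G)$ into $k$ nonempty parts such that for any two parts $V_i,V_j$, $V_i$ dominates $V_j$ or $V_j$ dominates $V_i$ (or both); $D(G)$ is the maximum such $k$. *)

theory Defs
  imports "Graph_Theory.Pair_Digraph" "HOL-Library.Disjoint_Sets"
begin

text \<open>
  A finite simple graph is a \<open>pair_graph\<close>: a finite, loop-free, symmetric digraph whose arcs are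
  ordered pairs of vertices. An undirected edge \<open>uv\<close> is represented by the two arcs
  \<open>(u, v)\<close> and \<open>(v, u)\<close>.
\<close>

definition complement :: "'a pair_pre_digraph \<Rightarrow> 'a pair_pre_digraph" where
  "complement G = \<lparr>pverts = pverts G,
     parcs = {(u, v). u \<in> pverts G \<and> v \<in> pverts G \<and> u \<noteq> v \<and> (u, v) \<notin> parcs G}\<rparr>"

text \<open>As usual, either side of the bipartition may be empty.\<close>

definition bipartite :: "'a pair_pre_digraph \<Rightarrow> bool" where
  "bipartite G \<longleftrightarrow> (\<exists>X Y. X \<union> Y = pverts G \<and> X \<inter> Y = {} \<and>
     (\<forall>(u, v) \<in> parcs G. u \<in> X \<and> v \<in> Y \<or> u \<in> Y \<and> v \<in> X))"

definition dominates_set :: "'a pair_pre_digraph \<Rightarrow> 'a set \<Rightarrow> 'a set \<Rightarrow> bool" where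
  "dominates_set G A B \<longleftrightarrow> (\<forall>b\<in>B. \<exists>a\<in>A. (a, b) \<in> parcs G)"

text \<open>
  The ordered parts \<open>V\<^sub>1, \<dots>, V\<^sub>k\<close> are given as a list; \<open>sorted_wrt\<close> requires the relation for all
  positions \<open>i < j\<close>, not only for adjacent ones. Nonemptiness of the parts is included in
  \<open>partition_on\<close>.
\<close>

definition transitive_partition :: "'a pair_pre_digraph \<Rightarrow> 'a set list \<Rightarrow> bool" where
  "transitive_partition G Vs \<longleftrightarrow>
     distinct Vs \<and> partition_on (pverts G) (set Vs) \<and> sorted_wrt (dominates_set G) Vs"

definition upper_domatic_partition :: "'a pair_pre_digraph \<Rightarrow> 'a set set \<Rightarrow> bool" where
  "upper_domatic_partition G P \<longleftrightarrow> partition_on (pverts G) P \<and>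
     (\<forall>A\<in>P. \<forall>B\<in>P. A \<noteq> B \<longrightarrow> dominates_set G A B \<or> dominates_set G B A)"

text \<open>
  For a finite graph both maxima range over finite nonempty sets, as shown below; for the graph
  without vertices the only partition is the empty one, and both numbers are \<open>0\<close>.
\<close>

definition Tr :: "'a pair_pre_digraph \<Rightarrow> nat" where
  "Tr G = Max {length Vs |Vs. transitive_partition G Vs}"

definition D :: "'a pair_pre_digraph \<Rightarrow> nat" where
  "D G = Max {card P |P. upper_domatic_partition G P}"

lemma pair_graph_complement:
  assumes "pair_graph G"
  shows "pair_graph (complement G)"
proof -
  interpret pair_graph G by fact
  have "finite (parcs (complement G))"
    by (rule finite_subset[of _ "pverts G \<times> pverts G"]) (auto simp: complement_def)
  then show ?thesis
    using arcs_symmetric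
    by unfold_locales (auto simp: complement_def symmetric_def arcs_ends_def arc_to_ends_def sym_def)
qed

lemma upper_domatic_partitions_bounded:
  assumes "finite (pverts G)"
  shows "finite {card P |P. upper_domatic_partition G P}"
proof -
  have "{card P |P. upper_domatic_partition G P} \<subseteq> card ` {P. partition_on (pverts G) P}"
    by (auto simp: upper_domatic_partition_def)
  then show ?thesis
    using finitely_many_partition_on[OF assms] by (meson finite_imageI finite_subset)
qed

lemma transitive_imp_upper_domatic_partition:
  assumes "transitive_partition G Vs"
  shows "upper_domatic_partition G (set Vs)" and "card (set Vs) = length Vs"
proof -
  show "card (set Vs) = length Vs"
    using assms by (simp add: transitive_partition_def distinct_card)
  have "dominates_set G A B \<or> dominates_set G B A" if AB: "A \<in> set Vs" "B \<in> set Vs" "A \<noteq> B" for A B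
  proof -
    obtain i j where ij: "i < length Vs" "j < length Vs" "A = Vs ! i" "B = Vs ! j"
      using AB by (auto simp: in_set_conv_nth)
    with AB have "i < j \<or> j < i" by (metis linorder_neqE_nat)
    then show ?thesis
      using assms ij by (auto simp: transitive_partition_def sorted_wrt_iff_nth_less)
  qed
  then show "upper_domatic_partition G (set Vs)"
    using assms by (auto simp: transitive_partition_def upper_domatic_partition_def)
qed

lemma transitive_partitions_bounded:
  assumes "finite (pverts G)"
  shows "finite {length Vs |Vs. transitive_partition G Vs}"
proof (rule finite_subset[OF _ upper_domatic_partitions_bounded[OF assms]])
  show "{length Vs |Vs. transitive_partition G Vs} \<subseteq> {card P |P. upper_domatic_partition G P}"
    using transitive_imp_upper_domatic_partition by (smt (verit) Collect_mono)
qed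

lemma ex_transitive_partition: "\<exists>Vs. transitive_partition G Vs"
proof (cases "pverts G = {}")
  case True
  then have "transitive_partition G []"
    by (simp add: transitive_partition_def partition_on_def)
  then show ?thesis ..
next
  case False
  then have "transitive_partition G [pverts G]"
    by (simp add: transitive_partition_def partition_on_space)
  then show ?thesis ..
qed

lemma ex_upper_domatic_partition: "\<exists>P. upper_domatic_partition G P"
  using ex_transitive_partition transitive_imp_upper_domatic_partition(1) by metis

end

theory Submission
  imports Defs
begin

text \<open>
  A complement of a bipartite graph is covered by two cliques \<open>X\<close> and \<open>Y\<close>. A part meeting both
  cliques dominates every other part. If an upper domatic partition has parts \<open>A \<subseteq> X\<close> and
  \<open>B \<subseteq> Y\<close> with at least two vertices each, then \<open>A \<union> B\<close> can be redistributed into two parts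
  meeting both cliques, so we may assume that no such pair exists; say all parts inside \<open>X\<close> are
  singletons. A singleton that dominates a nonempty set is also dominated by it. Hence listing first
  the parts meeting both cliques, then those inside \<open>Y\<close>, then those inside \<open>X\<close> gives a
  transitive partition with the same number of parts.
\<close>

text \<open>Arcs between \<open>X\<close> and \<open>Y\<close> are left arbitrary up to symmetry.
  The cliques are parameters, so that any result about \<open>X\<close> can be reused for
  \<open>Y\<close>.\<close>

locale two_clique_cover =
  fixes G :: "'a pair_pre_digraph" and X Y :: "'a set"
  assumes finite_verts: "finite (pverts G)"
    and cover: "X \<union> Y = pverts G"
    and disjoint: "X \<inter> Y = {}"
    and sym_arcs: "(u, v) \<in> parcs G \<Longrightarrow> (v, u) \<in> parcs G"
    and clique_X: "u \<in> X \<Longrightarrow> v \<in> X \<Longrightarrow> u \<noteq> v \<Longrightarrow> (u, v) \<in> parcs G"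
    and clique_Y: "u \<in> Y \<Longrightarrow> v \<in> Y \<Longrightarrow> u \<noteq> v \<Longrightarrow> (u, v) \<in> parcs G"

lemma two_clique_cover_complement:
  assumes "pair_graph H" and "bipartite H"
  shows "\<exists>X Y. two_clique_cover (complement H) X Y"
proof -
  interpret pair_graph H by fact
  interpret C: pair_graph "complement H" using assms(1) by (rule pair_graph_complement)
  obtain X Y where XY: "X \<union> Y = pverts H" "X \<inter> Y = {}"
    and bip: "\<forall>(u, v)\<in>parcs H. u \<in> X \<and> v \<in> Y \<or> u \<in> Y \<and> v \<in> X"
    using assms(2) unfolding bipartite_def by blast
  have "(u, v) \<notin> parcs H" if "u \<in> X \<and> v \<in> X \<or> u \<in> Y \<and> v \<in> Y" for u v
    using that bip XY(2) by blast
  moreover have "u \<in> pverts H" if "u \<in> X \<or> u \<in> Y" for u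
    using that XY(1) by blast
  ultimately have "two_clique_cover (complement H) X Y"
  proof unfold_locales
    show "(v, u) \<in> parcs (complement H)" if "(u, v) \<in> parcs (complement H)" for u v
      using that C.arcs_symmetric by blast
  qed (use XY C.pair_finite_verts in \<open>simp_all add: complement_def\<close>)
  then show ?thesis by blast
qed

lemma sorted_wrt_if_pairwise:
  assumes "distinct xs" and "\<And>x y. x \<in> set xs \<Longrightarrow> y \<in> set xs \<Longrightarrow> x \<noteq> y \<Longrightarrow> R x y"
  shows "sorted_wrt R xs"
  using assms by (induction xs) auto

text \<open>Any vertex of \<open>B\<close> can only be dominated by \<open>a\<close> itself; the
  reverse of that arc dominates \<open>a\<close>.\<close>

lemma dominates_set_singletonD:
  assumes "\<And>u v. (u, v) \<in> parcs G \<Longrightarrow> (v, u) \<in> parcs G"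
    and "dominates_set G {a} B" and "B \<noteq> {}"
  shows "dominates_set G B {a}"
  using assms unfolding dominates_set_def by blast

context two_clique_cover
begin

lemma swap: "two_clique_cover G Y X"
  using finite_verts cover disjoint sym_arcs clique_X clique_Y by unfold_locales auto

text \<open>A vertex of \<open>B\<close> is adjacent to every vertex of \<open>A\<close> in its own
  clique, the two being distinct by disjointness. Arcs between the cliques do not enter.\<close>

lemma dominates_setI:
  assumes "B \<subseteq> pverts G" and "A \<inter> B = {}"
    and "B \<inter> X \<noteq> {} \<Longrightarrow> A \<inter> X \<noteq> {}" and "B \<inter> Y \<noteq> {} \<Longrightarrow> A \<inter> Y \<noteq> {}"
  shows "dominates_set G A B"
  unfolding dominates_set_def
proof
  fix b assume b: "b \<in> B"
  with assms(1) cover consider "b \<in> X" | "b \<in> Y" by blast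
  then show "\<exists>a\<in>A. (a, b) \<in> parcs G"
  proof cases
    case 1
    with assms b obtain a where "a \<in> A" "a \<in> X" "a \<noteq> b" by blast
    with 1 clique_X show ?thesis by blast
  next
    case 2
    with assms b obtain a where "a \<in> A" "a \<in> Y" "a \<noteq> b" by blast
    with 2 clique_Y show ?thesis by blast
  qed
qed

lemma transitive_partition_if_singletons:
  assumes P: "upper_domatic_partition G P"
    and sing: "\<And>A. A \<in> P \<Longrightarrow> A \<subseteq> X \<Longrightarrow> is_singleton A"
  shows "\<exists>Vs. transitive_partition G Vs \<and> length Vs = card P"
proof -
  have part: "partition_on (pverts G) P"
    and dom: "\<And>A B. A \<in> P \<Longrightarrow> B \<in> P \<Longrightarrow> A \<noteq> B \<Longrightarrow> dominates_set G A B \<or> dominates_set G B A"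
    using P unfolding upper_domatic_partition_def by auto
  have sub: "A \<subseteq> pverts G" and ne: "A \<noteq> {}" if "A \<in> P" for A
    using that part by (auto simp: partition_on_def)
  have disj: "A \<inter> B = {}" if "A \<in> P" "B \<in> P" "A \<noteq> B" for A B
    using part that by (auto simp: partition_on_def disjoint_def)
  have fin: "finite P" using finite_elements[OF finite_verts part] .
  define M where "M = {A \<in> P. A \<inter> X \<noteq> {} \<and> A \<inter> Y \<noteq> {}}"
  define PX where "PX = {A \<in> P. A \<subseteq> X}"
  define PY where "PY = {A \<in> P. A \<subseteq> Y}"
  have subP: "M \<subseteq> P" "PX \<subseteq> P" "PY \<subseteq> P" by (auto simp: M_def PX_def PY_def)
  obtain ms ys xs where lists: "set ms = M" "distinct ms" "set ys = PY" "distinct ys"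
      "set xs = PX" "distinct xs"
    using finite_distinct_list[of M] finite_distinct_list[of PX] finite_distinct_list[of PY]
      finite_subset[OF _ fin] subP by metis
  \<comment> \<open>Domination inside each block, and from \<open>ms\<close> to the other blocks,
    comes from the cliques alone. Only pairs from \<open>ys\<close> and \<open>xs\<close> depend on
    arcs between the cliques.\<close>
  let ?Vs = "ms @ ys @ xs"
  have M_dom: "dominates_set G A B" if "A \<in> M" "B \<in> P" "A \<noteq> B" for A B
    using that sub disj by (intro dominates_setI) (auto simp: M_def)
  have X_dom: "dominates_set G A B" if "A \<in> PX" "B \<in> PX" "A \<noteq> B" for A B
    using that sub[of B] ne[of A] disj[of A B] disjoint
    by (intro dominates_setI) (auto simp: PX_def)
  have Y_dom: "dominates_set G A B" if "A \<in> PY" "B \<in> PY" "A \<noteq> B" for A B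
    using that sub[of B] ne[of A] disj[of A B] disjoint
    by (intro dominates_setI) (auto simp: PY_def)
  have neq: "B \<noteq> A" if "B \<in> PY" "A \<in> PX" for A B
    using that ne[of A] disjoint by (auto simp: PX_def PY_def)
  have YX_dom: "dominates_set G B A" if BA: "B \<in> PY" "A \<in> PX" for A B
  proof -
    obtain a where "A = {a}" using sing BA by (auto simp: PX_def is_singleton_def)
    \<comment> \<open>The hypothesis on \<open>P\<close> gives domination in one unknown direction;
      if it runs from \<open>{a}\<close> to \<open>B\<close>, it can be reversed.\<close>
    with dom[of B A] neq[OF BA] BA ne[of B] dominates_set_singletonD[OF sym_arcs, of a B]
    show ?thesis by (auto simp: PX_def PY_def)
  qed
  have M_neq: "A \<notin> PX \<and> A \<notin> PY" if "A \<in> M" for A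
    using that disjoint by (auto simp: M_def PX_def PY_def)
  have dist: "distinct ?Vs"
    using lists M_neq neq by auto
  have "A \<in> M \<or> A \<in> PY \<or> A \<in> PX" if "A \<in> P" for A
    using that sub[OF that] cover unfolding M_def PX_def PY_def by blast
  then have set: "set ?Vs = P"
    using lists subP by auto
  have "sorted_wrt (dominates_set G) ms"
    using lists M_dom subP(1) by (intro sorted_wrt_if_pairwise) blast+
  moreover have "sorted_wrt (dominates_set G) ys"
    using lists Y_dom by (intro sorted_wrt_if_pairwise) blast+
  moreover have "sorted_wrt (dominates_set G) xs"
    using lists X_dom by (intro sorted_wrt_if_pairwise) blast+
  moreover have "\<forall>A\<in>M. \<forall>B\<in>PY \<union> PX. dominates_set G A B"
    using M_dom M_neq subP by (metis UnE subsetD)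
  ultimately have "sorted_wrt (dominates_set G) ?Vs"
    using lists YX_dom by (simp add: sorted_wrt_append)
  then have "transitive_partition G ?Vs"
    using dist set part by (simp add: transitive_partition_def)
  then show ?thesis using distinct_card[OF dist] set by metis
qed

text \<open>The strict inclusion makes the number of parts inside a single clique a decreasing
  measure, so the exchange can be iterated.\<close>

lemma redistribute:
  assumes P: "upper_domatic_partition G P"
    and A: "A \<in> P" "A \<subseteq> X" "\<not> is_singleton A" and B: "B \<in> P" "B \<subseteq> Y" "\<not> is_singleton B"
  shows "\<exists>Q. upper_domatic_partition G Q \<and> card Q = card P \<and>
    {C \<in> Q. C \<subseteq> X \<or> C \<subseteq> Y} \<subset> {C \<in> P. C \<subseteq> X \<or> C \<subseteq> Y}"
proof -
  have part: "partition_on (pverts G) P"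
    and dom: "\<And>A B. A \<in> P \<Longrightarrow> B \<in> P \<Longrightarrow> A \<noteq> B \<Longrightarrow> dominates_set G A B \<or> dominates_set G B A"
    using P unfolding upper_domatic_partition_def by auto
  have sub: "C \<subseteq> pverts G" and ne: "C \<noteq> {}" if "C \<in> P" for C
    using that part by (auto simp: partition_on_def)
  have un: "\<Union>P = pverts G" using part by (auto simp: partition_on_def)
  have disj: "C \<inter> D = {}" if "C \<in> P" "D \<in> P" "C \<noteq> D" for C D
    using part that by (auto simp: partition_on_def disjoint_def)
  have fin: "finite P" using finite_elements[OF finite_verts part] .
  obtain a a' where a: "a \<in> A" "a' \<in> A" "a \<noteq> a'"
    using A(3) ne[OF A(1)] by (metis is_singletonI')
  obtain b b' where b: "b \<in> B" "b' \<in> B" "b \<noteq> b'"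
    using B(3) ne[OF B(1)] by (metis is_singletonI')
  have AB: "A \<noteq> B" "A \<inter> B = {}" using a(1) A(2) B(2) disjoint by auto
  \<comment> \<open>\<open>C\<close> takes one vertex from each clique; the remainder
    \<open>D\<close> keeps \<open>a'\<close> and \<open>b'\<close>, so it meets both cliques
    too.\<close>
  define C where "C = {a, b}"
  define D where "D = A \<union> B - {a, b}"
  have CD: "C \<inter> D = {}" "C \<union> D = A \<union> B" using a b by (auto simp: C_def D_def)
  have C: "C \<inter> X \<noteq> {}" "C \<inter> Y \<noteq> {}" using a b A B by (auto simp: C_def)
  have "a' \<in> D" "b' \<in> D" using a b AB by (auto simp: D_def)
  then have D: "D \<inter> X \<noteq> {}" "D \<inter> Y \<noteq> {}" using a b A B by blast+
  define R where "R = P - {A, B}"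
  have R: "E \<inter> (A \<union> B) = {}" if "E \<in> R" for E
    using that disj A B by (auto simp: R_def)
  have R': "E \<inter> C = {}" "E \<inter> D = {}" if "E \<in> R" for E
    using R[OF that] CD by blast+
  \<comment> \<open>A nonempty set disjoint from all members of \<open>R\<close> is not among them.
    Hence replacing \<open>A\<close>, \<open>B\<close> by \<open>C\<close>, \<open>D\<close>
    preserves the number of parts.\<close>
  have notin: "C \<notin> R" "D \<notin> R" using R' C D by blast+
  have CneD: "C \<noteq> D" using CD C by auto
  define Q where "Q = insert C (insert D R)"
  have PR: "P = insert A (insert B R)" "A \<notin> R" "B \<notin> R" using A B by (auto simp: R_def)
  have finR: "finite R" using fin by (simp add: R_def)
  have card: "card Q = card P"
    using finR PR notin CneD AB by (simp add: Q_def)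
  have partQ: "partition_on (pverts G) Q"
  proof (rule partition_onI)
    have "\<Union> Q = (C \<union> D) \<union> \<Union> R" by (simp add: Q_def Un_assoc)
    also have "\<dots> = \<Union> P" unfolding CD(2) by (subst PR(1)) (simp add: Un_assoc)
    finally show "\<Union> Q = pverts G" using un by simp
    have "{} \<notin> R" using ne by (auto simp: R_def)
    then show "{} \<notin> Q" using C D by (auto simp: Q_def)
    show "disjnt E F" if "E \<in> Q" "F \<in> Q" "E \<noteq> F" for E F
    proof -
      have "E \<inter> F = {}" if "E \<in> R" "F \<in> R"
        using that \<open>E \<noteq> F\<close> disj by (simp add: R_def)
      then show ?thesis
        using that CD(1) R'[of E] R'[of F] unfolding disjnt_def Q_def by blast
    qed
  qed
  have mixed: "dominates_set G E F" if "E = C \<or> E = D" "F \<in> Q" "E \<noteq> F" for E F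
  proof (rule dominates_setI)
    have E: "E \<in> Q" using that by (auto simp: Q_def)
    show "F \<subseteq> pverts G" using partQ that by (auto simp: partition_on_def)
    show "E \<inter> F = {}" using partQ that(2,3) E by (auto simp: partition_on_def disjoint_def)
  qed (use that C D in auto)
  have "upper_domatic_partition G Q"
    unfolding upper_domatic_partition_def
  proof (intro conjI partQ ballI impI)
    fix E F assume "E \<in> Q" "F \<in> Q" "E \<noteq> F"
    then show "dominates_set G E F \<or> dominates_set G F E"
      \<comment> \<open>Pairs involving \<open>C\<close> or \<open>D\<close> are settled by
        \<open>mixed\<close>; any other pair consists of two old parts.\<close>
      using mixed[of E F] mixed[of F E] dom[of E F] unfolding Q_def R_def by blast
  qed
  \<comment> \<open>The new parts meet both cliques and are not counted, whereas \<open>A\<close>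
    was counted and is gone.\<close>
  moreover have "{E \<in> Q. E \<subseteq> X \<or> E \<subseteq> Y} \<subseteq> {E \<in> P. E \<subseteq> X \<or> E \<subseteq> Y} - {A}"
    using C D disjoint unfolding Q_def R_def by blast
  ultimately show ?thesis using card A(1,2) by blast
qed

text \<open>Redistribution is repeated by induction on the number of parts inside one clique, until
  one clique contains only singleton parts.\<close>

lemma ex_transitive_partition_card:
  assumes "upper_domatic_partition G P"
  shows "\<exists>Vs. transitive_partition G Vs \<and> length Vs = card P"
  using assms
proof (induction "card {C \<in> P. C \<subseteq> X \<or> C \<subseteq> Y}" arbitrary: P rule: less_induct)
  case less
  show ?case
  proof (cases "\<exists>A\<in>P. \<exists>B\<in>P. A \<subseteq> X \<and> B \<subseteq> Y \<and> \<not> is_singleton A \<and> \<not> is_singleton B")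
    case True
    then obtain A B where "A \<in> P" "A \<subseteq> X" "\<not> is_singleton A"
      "B \<in> P" "B \<subseteq> Y" "\<not> is_singleton B"
      by blast
    from redistribute[OF less.prems this] obtain Q where Q: "upper_domatic_partition G Q" "card Q = card P"
      "{C \<in> Q. C \<subseteq> X \<or> C \<subseteq> Y} \<subset> {C \<in> P. C \<subseteq> X \<or> C \<subseteq> Y}"
      by blast
    have "finite P"
      using less.prems finite_elements[OF finite_verts] by (auto simp: upper_domatic_partition_def)
    then have "card {C \<in> Q. C \<subseteq> X \<or> C \<subseteq> Y} < card {C \<in> P. C \<subseteq> X \<or> C \<subseteq> Y}"
      using Q(3) by (intro psubset_card_mono) auto
    then show ?thesis using less.hyps[OF _ Q(1)] Q(2) by simp
  next
    case False
    \<comment> \<open>With no bad pair left, large parts lie inside at most one of the cliques. The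
      second case is the first one after \<open>swap\<close>.\<close>
    then consider "\<And>A. A \<in> P \<Longrightarrow> A \<subseteq> X \<Longrightarrow> is_singleton A"
      | "\<And>A. A \<in> P \<Longrightarrow> A \<subseteq> Y \<Longrightarrow> is_singleton A" by blast
    then show ?thesis
      using transitive_partition_if_singletons[OF less.prems]
        two_clique_cover.transitive_partition_if_singletons[OF swap less.prems]
      by cases blast+
  qed
qed

lemma Tr_eq_D: "Tr G = D G"
proof -
  \<comment> \<open>Every attainable size is shared, not just the largest, so the two maxima are
    taken over the same set.\<close>
  have "{length Vs |Vs. transitive_partition G Vs} = {card P |P. upper_domatic_partition G P}"
  proof (intro set_eqI iffI)
    fix n assume "n \<in> {length Vs |Vs. transitive_partition G Vs}"
    then show "n \<in> {card P |P. upper_domatic_partition G P}"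
      using transitive_imp_upper_domatic_partition[of G] by force
  next
    fix n assume "n \<in> {card P |P. upper_domatic_partition G P}"
    then show "n \<in> {length Vs |Vs. transitive_partition G Vs}"
      using ex_transitive_partition_card by force
  qed
  then show ?thesis by (simp add: Tr_def D_def)
qed

end

theorem theorem4:
  fixes G H :: "'a pair_pre_digraph"
  assumes "pair_graph H" and "bipartite H" and "G = complement H"
  shows "Tr G = D G"
  using two_clique_cover_complement[OF assms(1,2)] two_clique_cover.Tr_eq_D assms(3) by blast

end
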